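(* Assume that $b=c\geq 2$. Let $n\geq 3$. Then \begin{equation*} x_n= x_1^{-a_{n-1}} x_2^{-a_{n-2}} \sum_{ t_0,t_1,\cdots,t_{n-2}} \left[ \left( \prod_{i=0}^{n-2} \genfrac{[}{]}{0pt}{}{a_{i+1} - cs_i}{t_i} \right)x_1^{cs_{n-2}} x_2^{c(a_{n-1}-s_{n-1})}\right], \end{equation*} where $s_i=\sum_{j=0}^{i-1} a_{i-j+1}t_j$, and the summation runs over all integers $t_0,\dots,t_{n-2}$ satisfying $0\leq t_i \leq a_{i+1} - cs_i$ for $0\leq i\leq n-3$, and $s_{n-1} a_{n-2} -s_{n-2} a_{n-1} \geq 0$.
   Context: Let $b,c$ be positive integers and $x_1,x_2$ indeterminates. The cluster variables $x_m$, $m\in\mathbb{Z}$, of the coefficient-free cluster algebra $\mathcal{A}(b,c)\subset\mathbb{Q}(x_1,x_2)$ satisfy $x_{n+1}=(x_n^b+1)/x_{n-1}$ if $n$ is odd and $x_{n+1}=(x_n^c+1)/x_{n-1}$ if $n$ is even. The sequence $\{a_n\}$ is defined by $a_1=0$, $a_2=1$, $a_n=ca_{n-1}-a_{n-2}$. For arbitrary (possibly negative) integers $A,B$ the modified binomial coefficient is $\genfrac{[}{]}{0pt}{}{A}{B}=\prod_{i=0}^{A-B-1}\frac{A-i}{A-B-i}$ if $A>B$, $=1$ if $A=B$, and $=0$ if $A<B$. An empty product is defined to be $1$. *)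

theory Defs
  imports
    "HOL-Computational_Algebra.Polynomial"
    "HOL-Computational_Algebra.Fraction_Field"
    "HOL-Library.FuncSet"
begin

text \<open>The field \<open>\<rat>(x\<^sub>1, x\<^sub>2)\<close> is realised as the fraction field of \<open>\<rat>[x\<^sub>1][x\<^sub>2]\<close>.\<close>

type_synonym ratfun2 = "rat poly poly fract"

definition X1 :: ratfun2 where
  "X1 = Fract [:[:0, 1:]:] 1"

definition X2 :: ratfun2 where
  "X2 = Fract [:0, 1:] 1"

text \<open>
  The exchange relation is solved forwards for \<open>m > 2\<close> and backwards for \<open>m < 1\<close>;
  \<open>cluster_var_recurrence\<close> below shows that it then holds, in its original form, at all integers.
\<close>

function cluster_var :: "nat \<Rightarrow> nat \<Rightarrow> int \<Rightarrow> ratfun2" where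
  "cluster_var b c m =
    (if m = 1 then X1
     else if m = 2 then X2
     else if m > 2 then
       (cluster_var b c (m - 1) ^ (if odd (m - 1) then b else c) + 1) / cluster_var b c (m - 2)
     else
       (cluster_var b c (m + 1) ^ (if odd (m + 1) then b else c) + 1) / cluster_var b c (m + 2))"
  by auto
termination
  by (relation "measure (\<lambda>(b, c, m). nat \<bar>2 * m - 3\<bar>)") auto

declare cluster_var.simps [simp del]

fun aseq :: "nat \<Rightarrow> nat \<Rightarrow> int" where
  "aseq c 0 = 0" \<comment> \<open>irrelevant value: the sequence is indexed from 1\<close>
| "aseq c (Suc 0) = 0"
| "aseq c (Suc (Suc 0)) = 1"
| "aseq c (Suc (Suc (Suc n))) = int c * aseq c (Suc (Suc n)) - aseq c (Suc n)"

definition sseq :: "nat \<Rightarrow> (nat \<Rightarrow> int) \<Rightarrow> nat \<Rightarrow> int" where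
  "sseq c t i = (\<Sum>j<i. aseq c (i - j + 1) * t j)"

definition mod_binomial :: "int \<Rightarrow> int \<Rightarrow> 'a :: field_char_0" where
  "mod_binomial A B =
    (if A > B then \<Prod>i<nat (A - B). of_int (A - int i) / of_int (A - B - int i)
     else if A = B then 1
     else 0)"

text \<open>
  Tuples \<open>(t\<^sub>0, \<dots>, t\<^sub>n\<^sub>-\<^sub>2)\<close> are functions that are \<^const>\<open>undefined\<close> outside \<open>{0..n-2}\<close>.
  The last entry has no upper bound (and, for \<open>n = 3\<close>, no lower bound either), so this set is
  infinite; by \<open>finite_nonzero_terms\<close> below, only finitely many of its elements have a nonzero
  product of modified binomial coefficients. Sums over it must therefore be taken with
  \<^const>\<open>sum'\<close>, the sum of a finitely supported family.
\<close>

definition summation_tuples :: "nat \<Rightarrow> nat \<Rightarrow> (nat \<Rightarrow> int) set" where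
  "summation_tuples c n =
    {t \<in> {0..n-2} \<rightarrow>\<^sub>E UNIV.
       (\<forall>i\<in>{0..n-3}. 0 \<le> t i \<and> t i \<le> aseq c (i + 1) - int c * sseq c t i) \<and>
       sseq c t (n - 1) * aseq c (n - 2) - sseq c t (n - 2) * aseq c (n - 1) \<ge> 0}"


lemma X1_pos: "X1 > 0" and X2_pos: "X2 > 0"
  unfolding X1_def X2_def
  by (subst zero_less_Fract_iff, simp, simp add: less_poly_def pos_poly_pCons one_pCons)+

lemma cluster_var_pos: "cluster_var b c m > 0"
proof (induction b c m rule: cluster_var.induct)
  case (1 b c m)
  show ?case
  proof (cases "m = 1 \<or> m = 2")
    case True
    then show ?thesis by (subst cluster_var.simps) (auto simp: X1_pos X2_pos)
  next
    case False
    then show ?thesis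
      using 1 by (subst cluster_var.simps) (auto intro!: divide_pos_pos add_nonneg_pos)
  qed
qed

lemma cluster_var_1: "cluster_var b c 1 = X1" and cluster_var_2: "cluster_var b c 2 = X2"
  by (subst cluster_var.simps; simp)+

lemma cluster_var_recurrence:
  "cluster_var b c (n + 1) =
    (cluster_var b c n ^ (if odd n then b else c) + 1) / cluster_var b c (n - 1)"
proof (cases "n \<ge> 2")
  case True
  then show ?thesis
    by (subst cluster_var.simps) (auto simp: algebra_simps)
next
  case False
  define E where "E = cluster_var b c n ^ (if odd n then b else c) + 1"
  have "cluster_var b c (n - 1) = E / cluster_var b c (n + 1)"
    using False unfolding E_def by (subst cluster_var.simps) (auto simp: algebra_simps)
  moreover have "E \<noteq> 0" "cluster_var b c (n + 1) \<noteq> 0"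
    using cluster_var_pos[of b c n] cluster_var_pos[of b c "n + 1"]
    by (auto simp: E_def add_nonneg_eq_0_iff)
  ultimately show ?thesis
    unfolding E_def[symmetric] by simp
qed

lemma aseq_mono:
  assumes "c \<ge> 2"
  shows "0 \<le> aseq c (Suc n) \<and> aseq c (Suc n) < aseq c (Suc (Suc n))"
proof (induction n)
  case (Suc n)
  have "2 * aseq c (Suc (Suc n)) \<le> int c * aseq c (Suc (Suc n))"
    using assms Suc by (intro mult_right_mono) auto
  then show ?case using Suc unfolding aseq.simps by linarith
qed simp

lemma aseq_nonneg: "c \<ge> 2 \<Longrightarrow> 0 \<le> aseq c n"
  using aseq_mono[of c "n - 1"] by (cases n) auto

lemma finite_nonzero_terms:
  assumes "c \<ge> 2" "n \<ge> 3"
  shows "finite {t \<in> summation_tuples c n.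
    (\<Prod>i=0..n-2. mod_binomial (aseq c (i + 1) - int c * sseq c t i) (t i) :: 'a :: field_char_0) \<noteq> 0}"
    (is "finite ?S")
proof -
  define M where "M = (\<Sum>j<n-2. aseq c (n - j) * aseq c (j + 1))"
  have M: "M \<ge> 0"
    unfolding M_def using assms by (intro sum_nonneg mult_nonneg_nonneg aseq_nonneg) auto
  have "t \<in> {0..n-2} \<rightarrow>\<^sub>E {-M..M + aseq c (n - 1) + (\<Sum>i\<le>n. aseq c i)}" if t: "t \<in> ?S" for t
  proof -
    have ext: "t \<in> {0..n-2} \<rightarrow>\<^sub>E UNIV"
      and lo: "\<And>i. i \<le> n - 3 \<Longrightarrow> 0 \<le> t i"
      and up: "\<And>i. i \<le> n - 3 \<Longrightarrow> t i \<le> aseq c (i + 1) - int c * sseq c t i"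
      and last: "sseq c t (n - 1) * aseq c (n - 2) - sseq c t (n - 2) * aseq c (n - 1) \<ge> 0"
      using t by (auto simp: summation_tuples_def)
    have snn: "0 \<le> sseq c t i" if "i \<le> n - 2" for i
      unfolding sseq_def using that assms
      by (intro sum_nonneg mult_nonneg_nonneg aseq_nonneg lo) auto
    have up': "t i \<le> aseq c (i + 1)" if "i \<le> n - 3" for i
    proof -
      have "0 \<le> sseq c t i" by (rule snn) (use that assms in auto)
      then have "0 \<le> int c * sseq c t i" by simp
      then show ?thesis using up[OF that] by linarith
    qed
    have nz: "mod_binomial (aseq c (n - 1) - int c * sseq c t (n - 2)) (t (n - 2)) \<noteq> (0 :: 'a)"
    proof -
      have "Suc (n - 2) = n - 1" using assms by auto
      then show ?thesis using t by force
    qed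
    have tup: "t (n - 2) \<le> aseq c (n - 1) - int c * sseq c t (n - 2)"
      using nz by (auto simp: mod_binomial_def split: if_splits)
    have tlo: "t (n - 2) \<ge> - M"
    proof (cases "n = 3")
      case True
      have "t 0 = 0" using lo[of 0] up'[of 0] True by auto
      then have "sseq c t (n - 2) = 0" using True by (simp add: sseq_def)
      moreover have "aseq c (n - 1) = 1" using True by (simp add: numeral_2_eq_2)
      ultimately have "mod_binomial 1 (t (n - 2)) \<noteq> (0 :: 'a)" using nz by simp
      moreover have "mod_binomial 1 (t (n - 2)) = (0 :: 'a)" if "t (n - 2) < 0"
        using that unfolding mod_binomial_def by (auto intro!: bexI[of _ 1])
      ultimately show ?thesis using M by force
    next
      case False
      then obtain k where k: "n = Suc (Suc (Suc (Suc k)))"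
        using assms by (metis Suc_le_D Suc_le_mono eval_nat_numeral(3) le_antisym not_less_eq_eq numeral_2_eq_2)
      have "aseq c (n - 2) > 0" using aseq_mono[OF assms(1), of k] k by auto
      moreover have "sseq c t (n - 1) * aseq c (n - 2) \<ge> 0"
        using last snn[of "n - 2"] aseq_nonneg[OF assms(1), of "n - 1"]
          mult_nonneg_nonneg[of "sseq c t (n - 2)" "aseq c (n - 1)"] by linarith
      ultimately have "sseq c t (n - 1) \<ge> 0" by (simp add: zero_le_mult_iff)
      moreover have "sseq c t (n - 1) = (\<Sum>j<n-2. aseq c (n - j) * t j) + t (n - 2)"
      proof -
        have "n - 1 = Suc (n - 2)" using assms by auto
        moreover have "(\<Sum>j<n-2. aseq c (n - 1 - j + 1) * t j) = (\<Sum>j<n-2. aseq c (n - j) * t j)"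
          using assms by (intro sum.cong arg_cong2[where f = "(*)"] arg_cong2[where f = aseq]) auto
        moreover have "n - 1 - (n - 2) + 1 = Suc (Suc 0)" using assms by auto
        ultimately show ?thesis by (simp add: sseq_def)
      qed
      moreover have "(\<Sum>j<n-2. aseq c (n - j) * t j) \<le> M"
        unfolding M_def
      proof (intro sum_mono mult_left_mono aseq_nonneg assms(1))
        fix j assume "j \<in> {..<n-2}"
        then show "t j \<le> aseq c (j + 1)" by (intro up') auto
      qed
      ultimately show ?thesis by linarith
    qed
    have an: "aseq c i \<le> (\<Sum>i\<le>n. aseq c i)" if "i \<le> n" for i
      using that assms by (intro member_le_sum aseq_nonneg) auto
    have "t i \<in> {-M..M + aseq c (n - 1) + (\<Sum>i\<le>n. aseq c i)}" if i: "i \<le> n - 2" for i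
    proof (cases "i \<le> n - 3")
      case True
      then have "i + 1 \<le> n" using assms by simp
      then show ?thesis
        using lo[OF True] up'[OF True] an[of "i + 1"] M aseq_nonneg[OF assms(1), of "n - 1"] by auto
    next
      case False
      then have "i = n - 2" using i by auto
      moreover have "0 \<le> int c * sseq c t (n - 2)" using snn[of "n - 2"] by simp
      moreover have "0 \<le> (\<Sum>i\<le>n. aseq c i)" by (intro sum_nonneg aseq_nonneg assms)
      ultimately show ?thesis using tlo tup M by auto
    qed
    then show ?thesis using ext by (auto simp: PiE_iff)
  qed
  then have "?S \<subseteq> {0..n-2} \<rightarrow>\<^sub>E {-M..M + aseq c (n - 1) + (\<Sum>i\<le>n. aseq c i)}" by blast
  then show ?thesis by (rule finite_subset) (intro finite_PiE; simp)
qed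

end

theory Submission
  imports
    Defs
    "HOL-Computational_Algebra.Formal_Laurent_Series"
    "HOL-Library.Poly_Mapping"
    "HOL-Library.Product_Plus"
begin

text \<open>
  Write \<open>x\<^sub>n\<close> as a Laurent polynomial in \<open>x\<^sub>1, x\<^sub>2\<close> and substitute \<open>(x\<^sub>1, x\<^sub>2) \<mapsto> (x\<^sub>2, x\<^sub>3)\<close> with
  \<open>x\<^sub>3 = (x\<^sub>2\<^sup>c + 1) / x\<^sub>1\<close>. Expanding \<open>x\<^sub>3\<^sup>q\<close>, for \<open>q\<close> of either sign, by the binomial series in \<open>x\<^sub>2\<close>
  gives a recursion for the coefficients of \<open>x\<^sub>n\<^sub>+\<^sub>1\<close>. Iterating it while keeping only the terms with
  \<open>q \<ge> 0\<close> produces the sum over \<open>t\<^sub>0, \<dots>, t\<^sub>n\<^sub>-\<^sub>3\<close>, and \<open>t\<^sub>n\<^sub>-\<^sub>2\<close> comes from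
  the last expansion, where negative exponents are allowed.

  The omissions are harmless because \<open>x\<^sub>n\<close> is supported on exponents with
  \<open>a\<^sub>n\<^sub>-\<^sub>1 p + a\<^sub>n\<^sub>-\<^sub>2 q < 0\<close>, which is the last summation condition: giving \<open>x\<^sub>1, x\<^sub>2\<close> the degrees
  \<open>a\<^sub>n\<^sub>-\<^sub>1, a\<^sub>n\<^sub>-\<^sub>2\<close>, the exchange relation forces \<open>x\<^sub>k\<close> to have degree \<open>a\<^sub>n\<^sub>-\<^sub>k\<close> for \<open>k < n\<close> and \<open>x\<^sub>n\<close> to have
  negative degree. So a monomial of \<open>x\<^sub>n\<close> with \<open>p > 0\<close> has \<open>q < 0\<close>, and the substitution turns it into
  monomials with two positive exponents, which lie outside the next half-plane.
\<close>

section \<open>Laurent polynomials in two variables\<close>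

type_synonym laurent2 = "int \<times> int \<Rightarrow>\<^sub>0 int"

text \<open>Evaluation takes place in an arbitrary field so that one Laurent polynomial can be read
  in Q(x1, x2), in iterated Laurent series, and in series graded by degree.\<close>

definition laurent_eval :: "'a::field \<Rightarrow> 'a \<Rightarrow> laurent2 \<Rightarrow> 'a" where
  "laurent_eval u v f =
    (\<Sum>k\<in>Poly_Mapping.keys f. of_int (Poly_Mapping.lookup f k) * (u powi fst k * v powi snd k))"

lemma laurent_eval_add: "laurent_eval u v (f + g) = laurent_eval u v f + laurent_eval u v g"
  unfolding laurent_eval_def
  by (rule setsum_keys_plus_distrib[where f = "\<lambda>k a. of_int a * (u powi fst k * v powi snd k)"])
     (simp_all add: algebra_simps)

lemma laurent_eval_0 [simp]: "laurent_eval u v 0 = 0"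
  by (simp add: laurent_eval_def)

lemma laurent_eval_diff: "laurent_eval u v (f - g) = laurent_eval u v f - laurent_eval u v g"
  using laurent_eval_add[of u v "f - g" g] by simp

lemma laurent_eval_sum: "laurent_eval u v (\<Sum>i\<in>I. f i) = (\<Sum>i\<in>I. laurent_eval u v (f i))"
  by (induction I rule: infinite_finite_induct) (simp_all add: laurent_eval_add)

lemma laurent_eval_single:
  "laurent_eval u v (Poly_Mapping.single k a) = of_int a * (u powi fst k * v powi snd k)"
  by (simp add: laurent_eval_def)

lemma update_eq_single_plus:
  assumes "k \<notin> Poly_Mapping.keys f"
  shows "Poly_Mapping.update k a f = Poly_Mapping.single k a + f"
  using assms
  by (intro poly_mapping_eqI)
     (auto simp: lookup_add lookup_single lookup_update when_def in_keys_iff)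

lemma poly_mapping_single_add_induct [case_names zero add]:
  assumes "P 0" and "\<And>k a f. P f \<Longrightarrow> P (Poly_Mapping.single k a + f)"
  shows "P f"
  by (induction f rule: update_induct) (simp_all add: assms update_eq_single_plus)

lemma laurent_eval_mult:
  assumes "u \<noteq> 0" "v \<noteq> 0"
  shows "laurent_eval u v (f * g) = laurent_eval u v f * laurent_eval u v g"
proof (induction f rule: poly_mapping_single_add_induct)
  case (add k a f)
  have "laurent_eval u v (Poly_Mapping.single k a * g) =
      laurent_eval u v (Poly_Mapping.single k a) * laurent_eval u v g"
    by (induction g rule: poly_mapping_single_add_induct)
       (simp_all add: laurent_eval_add distrib_left mult_single laurent_eval_single
         power_int_add assms mult_ac)
  then show ?case
    by (simp add: add distrib_right laurent_eval_add)
qed simp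

lemma laurent_eval_1 [simp]: "laurent_eval u v 1 = 1"
  by (simp add: laurent_eval_def lookup_one)

lemma laurent_eval_power:
  assumes "u \<noteq> 0" "v \<noteq> 0"
  shows "laurent_eval u v (f ^ n) = laurent_eval u v f ^ n"
  by (induction n) (simp_all add: laurent_eval_mult assms)

lemma laurent_eval_of_nat: "laurent_eval u v (of_nat n) = of_nat n"
  by (induction n) (simp_all add: laurent_eval_add)

section \<open>A division-free recurrence for the cluster variables\<close>

text \<open>
  With \<open>y R(y) = (y\<^sup>c + 1)\<^sup>c - 1\<close>, the exchange relations at \<open>m + 1\<close>, \<open>m + 2\<close>, \<open>m + 3\<close> combine to
  \<open>x\<^sub>m\<^sub>+\<^sub>4 = x\<^sub>m x\<^sub>m\<^sub>+\<^sub>3\<^sup>c - R(x\<^sub>m\<^sub>+\<^sub>2)\<close>. Since \<open>x\<^sub>0, \<dots>, x\<^sub>3\<close> are Laurent polynomials, so are all \<open>x\<^sub>n\<close>.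
\<close>

definition exchange_remainder :: "nat \<Rightarrow> 'a::comm_ring_1 \<Rightarrow> 'a" where
  "exchange_remainder c y = (\<Sum>k<c. of_nat (c choose Suc k) * y ^ (c * Suc k - 1))"

lemma exchange_remainder:
  assumes "c \<ge> 1"
  shows "y * exchange_remainder c y = (y ^ c + 1) ^ c - 1"
proof -
  have "(y ^ c + 1) ^ c = (\<Sum>k\<le>c. of_nat (c choose k) * (y ^ c) ^ k)"
    by (subst binomial_ring) simp
  also have "\<dots> = 1 + (\<Sum>k<c. of_nat (c choose Suc k) * (y ^ c) ^ Suc k)"
    by (subst sum.atMost_shift) simp
  also have "(\<Sum>k<c. of_nat (c choose Suc k) * (y ^ c) ^ Suc k) = y * exchange_remainder c y"
    unfolding exchange_remainder_def sum_distrib_left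
  proof (rule sum.cong)
    fix k
    have "(y ^ c) ^ Suc k = y ^ (c * Suc k)"
      by (rule power_mult[symmetric])
    also have "\<dots> = y * y ^ (c * Suc k - 1)"
      using assms by (subst power_Suc[symmetric]) simp
    finally show "of_nat (c choose Suc k) * (y ^ c) ^ Suc k =
        y * (of_nat (c choose Suc k) * y ^ (c * Suc k - 1))"
      by (simp only: mult.left_commute)
  qed simp
  finally show ?thesis by simp
qed

text \<open>Only ring operations occur, so the recurrence runs inside \<open>laurent2\<close> and
  commutes with \<open>laurent_eval\<close> at nonzero arguments. No divisibility has to be
  proved.\<close>

fun exchange_seq :: "nat \<Rightarrow> 'a::comm_ring_1 \<Rightarrow> 'a \<Rightarrow> 'a \<Rightarrow> 'a \<Rightarrow> nat \<Rightarrow> 'a" where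
  "exchange_seq c z0 z1 z2 z3 0 = z0"
| "exchange_seq c z0 z1 z2 z3 (Suc 0) = z1"
| "exchange_seq c z0 z1 z2 z3 (Suc (Suc 0)) = z2"
| "exchange_seq c z0 z1 z2 z3 (Suc (Suc (Suc 0))) = z3"
| "exchange_seq c z0 z1 z2 z3 (Suc (Suc (Suc (Suc n)))) =
    exchange_seq c z0 z1 z2 z3 n * exchange_seq c z0 z1 z2 z3 (Suc (Suc (Suc n))) ^ c -
    exchange_remainder c (exchange_seq c z0 z1 z2 z3 (Suc (Suc n)))"

text \<open>For consecutive terms A, B, C, D, multiply the next term by C. Rewriting A * C as B^c +
  1 and C^c + 1 as B * D makes (B * D)^c cancel and leaves D^c + 1.\<close>

lemma exchange_seq_relation:
  assumes "c \<ge> 1" "z0 * z2 = z1 ^ c + 1" "z1 * z3 = z2 ^ c + 1"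
  shows "exchange_seq c z0 z1 z2 z3 n * exchange_seq c z0 z1 z2 z3 (Suc (Suc n)) =
    exchange_seq c z0 z1 z2 z3 (Suc n) ^ c + 1"
proof (induction n rule: less_induct)
  case (less n)
  let ?z = "exchange_seq c z0 z1 z2 z3"
  consider "n = 0" | "n = 1" | m where "n = Suc (Suc m)"
    by (metis One_nat_def not0_implies_Suc)
  then show ?case
  proof cases
    case 3
    define A B C D where "A = ?z m" and "B = ?z (Suc m)" and "C = ?z (Suc (Suc m))"
      and "D = ?z (Suc (Suc (Suc m)))"
    have AC: "A * C = B ^ c + 1" and BD: "B * D = C ^ c + 1"
      using less[of m] less[of "Suc m"] by (simp_all add: 3 A_def B_def C_def D_def)
    have "C * (A * D ^ c - exchange_remainder c C) = (A * C) * D ^ c - C * exchange_remainder c C"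
      by (simp add: algebra_simps)
    also have "\<dots> = (B ^ c + 1) * D ^ c - ((B * D) ^ c - 1)"
      by (simp only: AC BD exchange_remainder[OF assms(1)])
    also have "\<dots> = D ^ c + 1"
      by (simp add: power_mult_distrib algebra_simps)
    finally show ?thesis
      by (simp add: 3 A_def B_def C_def D_def)
  qed (use assms in simp_all)
qed

lemma exchange_seq_shift:
  "exchange_seq c z1 z2 z3 (exchange_seq c z0 z1 z2 z3 4) n = exchange_seq c z0 z1 z2 z3 (Suc n)"
proof (induction n rule: less_induct)
  case (less n)
  consider "n = 0" | "n = 1" | "n = 2" | "n = 3" | m where "n = Suc (Suc (Suc (Suc m)))"
    by (metis One_nat_def not0_implies_Suc numeral_2_eq_2 numeral_3_eq_3)
  then show ?case
  proof cases
    case 5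
    then show ?thesis
      using less[of m] less[of "Suc (Suc m)"] less[of "Suc (Suc (Suc m))"] by simp
  qed (simp_all add: eval_nat_numeral)
qed

definition cluster_seq :: "nat \<Rightarrow> 'a::field \<Rightarrow> 'a \<Rightarrow> nat \<Rightarrow> 'a" where
  "cluster_seq c u v = exchange_seq c ((u ^ c + 1) / v) u v ((v ^ c + 1) / u)"

lemma cluster_seq_simps [simp]:
  "cluster_seq c u v 0 = (u ^ c + 1) / v"
  "cluster_seq c u v (Suc 0) = u"
  "cluster_seq c u v (Suc (Suc 0)) = v"
  "cluster_seq c u v (Suc (Suc (Suc 0))) = (v ^ c + 1) / u"
  by (simp_all add: cluster_seq_def)

lemma cluster_seq_relation:
  assumes "c \<ge> 1" "u \<noteq> 0" "v \<noteq> 0"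
  shows "cluster_seq c u v n * cluster_seq c u v (Suc (Suc n)) = cluster_seq c u v (Suc n) ^ c + 1"
  unfolding cluster_seq_def using assms by (intro exchange_seq_relation) simp_all

text \<open>Solving the exchange relation backwards from the new pair returns u, so the four
  starting values of the new sequence are the old ones moved by one index.\<close>

lemma cluster_seq_shift:
  assumes "c \<ge> 1" "u \<noteq> 0" "v \<noteq> 0" "v ^ c + 1 \<noteq> 0"
  shows "cluster_seq c v ((v ^ c + 1) / u) n = cluster_seq c u v (Suc n)"
proof -
  let ?w = "(v ^ c + 1) / u"
  have "v * cluster_seq c u v 4 = ?w ^ c + 1"
    using cluster_seq_relation[OF assms(1-3), of 2] by (simp add: eval_nat_numeral)
  then have "(?w ^ c + 1) / v = cluster_seq c u v 4"
    using assms by (simp add: field_simps)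
  moreover have "(v ^ c + 1) / ?w = u"
    using assms by simp
  ultimately show ?thesis
    using exchange_seq_shift[of c u v ?w "(u ^ c + 1) / v" n]
    by (simp add: cluster_seq_def)
qed

definition laurent_var :: "nat \<Rightarrow> nat \<Rightarrow> laurent2" where
  "laurent_var c = exchange_seq c
     (Poly_Mapping.single (int c, - 1) 1 + Poly_Mapping.single (0, - 1) 1)
     (Poly_Mapping.single (1, 0) 1)
     (Poly_Mapping.single (0, 1) 1)
     (Poly_Mapping.single (- 1, int c) 1 + Poly_Mapping.single (- 1, 0) 1)"

lemma laurent_eval_exchange_seq:
  assumes "u \<noteq> 0" "v \<noteq> 0"
  shows "laurent_eval u v (exchange_seq c z0 z1 z2 z3 n) =
    exchange_seq c (laurent_eval u v z0) (laurent_eval u v z1) (laurent_eval u v z2)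
      (laurent_eval u v z3) n"
  by (induction c z0 z1 z2 z3 n rule: exchange_seq.induct)
     (simp_all add: laurent_eval_diff laurent_eval_mult laurent_eval_power laurent_eval_sum
       laurent_eval_of_nat exchange_remainder_def assms)

lemma laurent_eval_laurent_var:
  assumes "u \<noteq> 0" "v \<noteq> 0"
  shows "laurent_eval u v (laurent_var c n) = cluster_seq c u v n"
proof -
  have "(u ^ c + 1) / v = u ^ c * inverse v + inverse v" "(v ^ c + 1) / u = inverse u * v ^ c + inverse u"
    by (simp_all add: divide_inverse algebra_simps)
  then show ?thesis
    unfolding laurent_var_def cluster_seq_def
    by (simp add: laurent_eval_exchange_seq assms laurent_eval_add laurent_eval_single power_int_minus)
qed

lemma cluster_var_eq_cluster_seq:
  assumes "c \<ge> 1" "n \<ge> 1"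
  shows "cluster_var c c (int n) = cluster_seq c X1 X2 n"
  using assms(2)
proof (induction n rule: less_induct)
  case (less n)
  have nz: "X1 \<noteq> 0" "X2 \<noteq> 0"
    using X1_pos X2_pos by auto
  consider "n = 1" | "n = 2" | m where "n = Suc (Suc m)" "m \<ge> 1"
    using less.prems
    by (metis One_nat_def Suc_le_D le_0_eq not_less_eq_eq numeral_2_eq_2)
  then show ?case
  proof cases
    case 1
    then show ?thesis by (simp add: cluster_var_1)
  next
    case 2
    then show ?thesis using cluster_var_2[of c c] by (simp add: eval_nat_numeral)
  next
    case 3
    have "cluster_var c c (int n) = (cluster_var c c (int (Suc m)) ^ c + 1) / cluster_var c c (int m)"
      using cluster_var_recurrence[of c c "int (Suc m)"] by (simp add: 3 algebra_simps)
    also have "\<dots> = cluster_seq c X1 X2 m * cluster_seq c X1 X2 (Suc (Suc m)) / cluster_seq c X1 X2 m"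
      using less.IH[of m] less.IH[of "Suc m"] 3 cluster_seq_relation[OF assms(1) nz, of m] by simp
    also have "\<dots> = cluster_seq c X1 X2 n"
      using less.IH[of m] 3 cluster_var_pos[of c c "int m"] by simp
    finally show ?thesis .
  qed
qed

unbundle fps_syntax

section \<open>Coefficients of the Laurent expansions\<close>

lemma fls_sum_nth: "(\<Sum>i\<in>I. f i) $$ n = (\<Sum>i\<in>I. f i $$ n)"
  by (induction I rule: infinite_finite_induct) simp_all

lemma fls_const_mult_X_powi_nth:
  "(fls_const a * fls_X powi p) $$ i = (if i = p then a else (0::'a::field))"
  by (simp add: fls_X_intpow_times_conv_shift)

text \<open>In \<open>rat fls fls\<close> the outer variable stands for x1, and the inner one,
  embedded as a constant, stands for x2.\<close>

lemma laurent_monomial_nth: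
  "((fls_X :: rat fls fls) powi p * fls_const fls_X powi q) $$ i $$ j = (if (p, q) = (i, j) then 1 else 0)"
proof -
  have "(fls_X :: rat fls fls) powi p * fls_const fls_X powi q =
      fls_const (fls_const 1 * fls_X powi q) * fls_X powi p"
    by (simp only: fls_const_power_int fls_const_1 mult_1 mult.commute)
  then show ?thesis
    by (simp only: fls_const_mult_X_powi_nth) (auto simp: fls_const_mult_X_powi_nth)
qed

lemma laurent_eval_X_X_nth:
  "laurent_eval (fls_X :: rat fls fls) (fls_const fls_X) f $$ i $$ j =
    of_int (Poly_Mapping.lookup f (i, j))"
proof -
  have "laurent_eval (fls_X :: rat fls fls) (fls_const fls_X) f $$ i $$ j =
      (\<Sum>k\<in>Poly_Mapping.keys f. if k = (i, j) then of_int (Poly_Mapping.lookup f k) else 0)"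
    unfolding laurent_eval_def fls_sum_nth fls_mult_of_int_nth laurent_monomial_nth
    by (intro sum.cong) auto
  also have "\<dots> = of_int (Poly_Mapping.lookup f (i, j))"
    by (simp add: in_keys_iff)
  finally show ?thesis .
qed

text \<open>For c > 0 this is the coefficient of y^d in the power series (1 + y^c)^q, with q of
  either sign.\<close>

definition exchange_coeff :: "nat \<Rightarrow> int \<Rightarrow> int \<Rightarrow> rat" where
  "exchange_coeff c q d =
    (if 0 \<le> d \<and> int c dvd d then of_int q gchoose nat (d div int c) else 0)"

lemma fls_compose_power_inverse:
  fixes f :: "'a::field fls"
  assumes "d > 0"
  shows "fls_compose_power (inverse f) d = inverse (fls_compose_power f d)"
proof (cases "f = 0")
  case False
  then have "fls_compose_power f d * fls_compose_power (inverse f) d = 1"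
    using assms by (simp flip: fls_compose_power_mult)
  then show ?thesis
    by (metis inverse_unique)
qed simp

lemma fls_X_power_plus_1_powi_nth:
  assumes "c > 0"
  shows "(fls_X ^ c + 1) powi q $$ d = exchange_coeff c q d"
proof -
  have "fls_compose_power ((1 + fls_X) powi q) c = fls_compose_power (1 + fls_X :: rat fls) c powi q"
    using assms by (simp add: power_int_def fls_compose_power_inverse)
  also have "fls_compose_power (1 + fls_X) c = (fls_X ^ c + 1 :: rat fls)"
    using assms by (simp add: fls_X_power_conv_shift_1)
  finally have "(fls_X ^ c + 1) powi q $$ d =
      fls_compose_power (fps_to_fls (fps_binomial (of_int q :: rat))) c $$ d"
    by (simp only: one_plus_fls_X_powi_eq)
  also have "\<dots> = exchange_coeff c q d"
    using assms
    by (auto simp: fls_nth_compose_power exchange_coeff_def pos_imp_zdiv_neg_iff)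
  finally show ?thesis .
qed

text \<open>The monomial x1^p x2^q turns into x1^(-q) x2^p (1 + x2^c)^q, so only monomials with q =
  -i contribute.\<close>

lemma laurent_eval_shifted_nth:
  assumes "c > 0"
  shows "laurent_eval (fls_const fls_X) ((fls_const fls_X ^ c + 1) / fls_X :: rat fls fls) f $$ i $$ j =
    (\<Sum>k\<in>Poly_Mapping.keys f. of_int (Poly_Mapping.lookup f k) *
      (if i = - snd k then exchange_coeff c (snd k) (j - fst k) else 0))"
proof -
  have "(fls_const fls_X powi p * ((fls_const fls_X ^ c + 1) / fls_X) powi q :: rat fls fls) =
      fls_const ((fls_X ^ c + 1) powi q * fls_X powi p) * fls_X powi (- q)" for p q
  proof -
    have "(fls_const fls_X ^ c + 1 :: rat fls fls) = fls_const (fls_X ^ c + 1)"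
      by (simp flip: fls_const_power fls_plus_const)
    then have "((fls_const fls_X ^ c + 1) / fls_X) powi q =
        fls_const ((fls_X ^ c + 1) powi q) * (fls_X :: rat fls fls) powi (- q)"
      by (simp only: divide_inverse power_int_mult_distrib power_int_inverse power_int_minus fls_const_power_int)
    then show ?thesis
      by (simp only: fls_const_power_int mult_ac flip: fls_const_mult_const)
  qed
  then have "(fls_const fls_X powi p * ((fls_const fls_X ^ c + 1) / fls_X) powi q :: rat fls fls) $$ i $$ j =
      (if i = - q then exchange_coeff c q (j - p) else 0)" for p q
    by (simp only: fls_const_mult_X_powi_nth)
       (simp add: fls_X_intpow_times_conv_shift fls_X_power_plus_1_powi_nth[OF assms])
  then show ?thesis
    unfolding laurent_eval_def fls_sum_nth fls_mult_of_int_nth by simp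
qed

text \<open>By \<open>cluster_seq_shift\<close>, evaluating the Laurent polynomial of x_(n+1) at
  (x1, x2) agrees with evaluating that of x_n at (x2, x3). The recursion compares coefficients of
  the two series.\<close>

lemma laurent_var_Suc:
  assumes "c \<ge> 1"
  shows "of_int (Poly_Mapping.lookup (laurent_var c (Suc n)) (i, j)) =
    (\<Sum>k\<in>Poly_Mapping.keys (laurent_var c n). of_int (Poly_Mapping.lookup (laurent_var c n) k) *
      (if i = - snd k then exchange_coeff c (snd k) (j - fst k) else 0))"
proof -
  define u v :: "rat fls fls" where "u = fls_X" and "v = fls_const fls_X"
  have nz: "u \<noteq> 0" "v \<noteq> 0"
    by (simp_all add: u_def v_def)
  have "(fls_X ^ c + 1 :: rat fls) $$ 0 \<noteq> 0"
    using assms by (simp add: fls_X_power_nth)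
  then have "(fls_X ^ c + 1 :: rat fls) \<noteq> 0"
    by (metis fls_zero_nth)
  moreover have "v ^ c + 1 = fls_const (fls_X ^ c + 1)"
    by (simp add: v_def flip: fls_const_power fls_plus_const)
  ultimately have nz': "v ^ c + 1 \<noteq> 0"
    by (simp only: fls_const_eq_0_iff not_False_eq_True)
  have "laurent_eval v ((v ^ c + 1) / u) (laurent_var c n) = laurent_eval u v (laurent_var c (Suc n))"
    using assms nz nz' by (simp add: laurent_eval_laurent_var cluster_seq_shift)
  then have "laurent_eval v ((v ^ c + 1) / u) (laurent_var c n) $$ i $$ j =
      of_int (Poly_Mapping.lookup (laurent_var c (Suc n)) (i, j))"
    by (simp only: u_def v_def laurent_eval_X_X_nth)
  then show ?thesis
    using assms unfolding u_def v_def by (subst (asm) laurent_eval_shifted_nth) simp_all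
qed

section \<open>Degrees and the half-plane containing the support\<close>

lemma cluster_seq_subdegree:
  fixes u v :: "'a::field fls"
  assumes "c \<ge> 2" "u \<noteq> 0" "v \<noteq> 0"
    and "fls_subdegree u = - aseq c (Suc (m + k))" "fls_subdegree v = - aseq c (m + k)"
    and "m \<ge> 1"
  shows "cluster_seq c u v (Suc k) \<noteq> 0 \<and> fls_subdegree (cluster_seq c u v (Suc k)) = - aseq c (Suc m) \<and>
    cluster_seq c u v (Suc (Suc k)) \<noteq> 0 \<and> fls_subdegree (cluster_seq c u v (Suc (Suc k))) = - aseq c m"
  using assms(4-6)
proof (induction k arbitrary: m)
  case (Suc k)
  let ?z = "cluster_seq c u v"
  have IH: "?z (Suc k) \<noteq> 0" "fls_subdegree (?z (Suc k)) = - aseq c (Suc (Suc m))"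
    "?z (Suc (Suc k)) \<noteq> 0" "fls_subdegree (?z (Suc (Suc k))) = - aseq c (Suc m)"
    using Suc.IH[of "Suc m"] Suc.prems by simp_all
  \<comment> \<open>\<open>aseq c 0\<close> is a default value outside the recurrence, so the
    descent stops at m = 1.\<close>
  obtain m' where m: "m = Suc m'"
    using Suc.prems by (cases m) auto
  have pos: "aseq c (Suc m) > 0"
    using aseq_mono[OF assms(1), of m'] by (simp add: m)
  \<comment> \<open>This power has positive degree, so adding 1 keeps the degree. Dividing by the
    earlier term leaves c a_(m+1) - a_(m+2) = a_m, the recurrence run downwards.\<close>
  have sub: "fls_subdegree (?z (Suc (Suc k)) ^ c) = - (int c * aseq c (Suc m))"
    by (simp add: fls_subdegree_pow IH)
  also have "\<dots> < 0"
    using pos assms(1) by simp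
  finally have "fls_subdegree (?z (Suc (Suc k)) ^ c + 1) = - (int c * aseq c (Suc m))"
    using sub IH by (subst fls_subdegree_add_eq1) simp_all
  moreover have rel: "?z (Suc k) * ?z (Suc (Suc (Suc k))) = ?z (Suc (Suc k)) ^ c + 1"
    using assms by (intro cluster_seq_relation) simp_all
  moreover have "?z (Suc (Suc (Suc k))) \<noteq> 0"
  proof
    assume "?z (Suc (Suc (Suc k))) = 0"
    then have "?z (Suc (Suc k)) ^ c + 1 = 0"
      using rel by simp
    then show False
      using calculation(1) pos assms(1) by simp
  qed
  ultimately have "fls_subdegree (?z (Suc (Suc (Suc k)))) = - aseq c m"
    using IH fls_subdegree_mult[of "?z (Suc k)" "?z (Suc (Suc (Suc k)))"] by (simp add: m)
  then show ?case
    using IH \<open>?z (Suc (Suc (Suc k))) \<noteq> 0\<close> by simp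
qed (use assms in simp_all)

text \<open>The grading by \<open>deg x\<^sub>1 = w1\<close>, \<open>deg x\<^sub>2 = w2\<close> is read off in an auxiliary variable of degree \<open>- 1\<close>.\<close>

lemma laurent_eval_weighted_nth:
  fixes w1 w2 :: int and a b :: "'a::field"
  shows "laurent_eval (fls_const a * fls_X powi (- w1)) (fls_const b * fls_X powi (- w2)) f $$ (- w) =
    (\<Sum>k\<in>Poly_Mapping.keys f. of_int (Poly_Mapping.lookup f k) *
      (if w1 * fst k + w2 * snd k = w then a powi fst k * b powi snd k else 0))"
proof -
  have "(fls_const a * fls_X powi (- w1)) powi p * (fls_const b * fls_X powi (- w2)) powi q =
      fls_const (a powi p * b powi q) * fls_X powi (- (w1 * p + w2 * q))" for p q
  proof -
    have "(fls_X powi (- w1)) powi p * (fls_X powi (- w2)) powi q =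
        (fls_X :: 'a fls) powi (- w1 * p + - w2 * q)"
      by (subst power_int_add) (simp_all only: power_int_mult fls_X_nonzero simp_thms)
    also have "- w1 * p + - w2 * q = - (w1 * p + w2 * q)"
      by simp
    finally show ?thesis
      by (simp only: power_int_mult_distrib fls_const_power_int mult_ac flip: fls_const_mult_const)
  qed
  then have "((fls_const a * fls_X powi (- w1)) powi p * (fls_const b * fls_X powi (- w2)) powi q) $$ (- w) =
      (if w1 * p + w2 * q = w then a powi p * b powi q else 0)" for p q
    by (simp only: fls_const_mult_X_powi_nth) auto
  then show ?thesis
    unfolding laurent_eval_def fls_sum_nth fls_mult_of_int_nth by simp
qed

text \<open>With these weights x_(n-2) has degree 1 and x_(n-1) has degree 0, so x_(n-1)^c + 1 has
  degree at most 0 and x_n has degree at most -1.\<close>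

lemma laurent_var_support:
  assumes "c \<ge> 2" "n \<ge> 3" "Poly_Mapping.lookup (laurent_var c n) (p, q) \<noteq> 0"
  shows "aseq c (n - 1) * p + aseq c (n - 2) * q < 0"
proof (rule ccontr)
  define w where "w = aseq c (n - 1) * p + aseq c (n - 2) * q"
  \<comment> \<open>Keeping x1 and x2 as scalars next to the grading variable separates monomials of
    equal weight, so each coefficient vanishes individually.\<close>
  define x1 x2 :: "rat fls fls" where "x1 = fls_X" and "x2 = fls_const fls_X"
  define u where "u = fls_const x1 * fls_X powi (- aseq c (n - 1))"
  define v where "v = fls_const x2 * fls_X powi (- aseq c (n - 2))"
  let ?z = "cluster_seq c u v"
  assume "\<not> aseq c (n - 1) * p + aseq c (n - 2) * q < 0"
  then have w: "w \<ge> 0"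
    by (simp add: w_def)
  obtain k where n: "n = Suc (Suc (Suc k))"
    using assms(2) by (intro that[of "n - 3"]) simp
  have nz: "u \<noteq> 0" "v \<noteq> 0"
    by (simp_all add: u_def v_def x1_def x2_def del: fls_X_power_int)
  have "fls_subdegree u = - aseq c (n - 1)" "fls_subdegree v = - aseq c (n - 2)"
    by (simp_all add: u_def v_def x1_def x2_def del: fls_X_power_int)
  then have IH: "?z (Suc k) \<noteq> 0" "fls_subdegree (?z (Suc k)) = - 1" "fls_subdegree (?z (Suc (Suc k))) = 0"
    using cluster_seq_subdegree[OF assms(1) nz, of 1 k] by (simp_all add: n)
  have rel: "?z (Suc k) * ?z n = ?z (Suc (Suc k)) ^ c + 1"
    unfolding n using assms(1) nz by (intro cluster_seq_relation) simp_all
  have "?z n $$ (- w) = 0"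
  proof (cases "?z n = 0")
    case False
    have "0 \<le> fls_subdegree (?z (Suc k) * ?z n)"
    proof (subst rel, rule fls_subdegree_geI)
      show "?z (Suc (Suc k)) ^ c + 1 \<noteq> 0"
        using False IH(1) rel by (metis mult_eq_0_iff)
      show "(?z (Suc (Suc k)) ^ c + 1) $$ i = 0" if "i < 0" for i
        using that IH(3) by (simp add: fls_subdegree_pow)
    qed
    then have "fls_subdegree (?z n) \<ge> 1"
      using False IH by simp
    then show ?thesis
      using w by (intro fls_eq0_below_subdegree) simp
  qed simp
  then have "laurent_eval u v (laurent_var c n) $$ (- w) = 0"
    by (simp add: laurent_eval_laurent_var nz)
  then have S: "(\<Sum>k\<in>Poly_Mapping.keys (laurent_var c n). of_int (Poly_Mapping.lookup (laurent_var c n) k) *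
      (if aseq c (n - 1) * fst k + aseq c (n - 2) * snd k = w
       then x1 powi fst k * x2 powi snd k else 0)) = 0"
    (is "?S = 0")
    unfolding u_def v_def by (simp only: laurent_eval_weighted_nth)
  have "?S $$ p $$ q = (\<Sum>k\<in>Poly_Mapping.keys (laurent_var c n).
      if k = (p, q) then of_int (Poly_Mapping.lookup (laurent_var c n) k) else 0)"
    unfolding fls_sum_nth fls_mult_of_int_nth
  proof (rule sum.cong)
    fix k :: "int \<times> int"
    have "(x1 powi fst k * x2 powi snd k) $$ p $$ q = (if k = (p, q) then 1 else 0)"
      unfolding x1_def x2_def laurent_monomial_nth by simp
    then show "of_int (Poly_Mapping.lookup (laurent_var c n) k) *
        ((if aseq c (n - 1) * fst k + aseq c (n - 2) * snd k = w
          then x1 powi fst k * x2 powi snd k else 0) $$ p $$ q) =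
        (if k = (p, q) then of_int (Poly_Mapping.lookup (laurent_var c n) k) else 0)"
      by (auto simp: w_def)
  qed simp
  then have "?S $$ p $$ q = of_int (Poly_Mapping.lookup (laurent_var c n) (p, q))"
    by (simp add: in_keys_iff)
  then show False
    using assms(3) unfolding S by simp
qed

section \<open>Sums over bounded tuples\<close>

text \<open>This is the bound on t_i, and it also gives the exponents of the summand: x1 has
  exponent -\<open>slack c t (n - 2)\<close> and x2 has exponent
  \<open>slack c t (n - 1)\<close>.\<close>

definition slack :: "nat \<Rightarrow> (nat \<Rightarrow> int) \<Rightarrow> nat \<Rightarrow> int" where
  "slack c t i = aseq c (Suc i) - int c * sseq c t i"

lemma sseq_Suc_Suc: "sseq c t (Suc (Suc i)) = t (Suc i) + int c * sseq c t (Suc i) - sseq c t i"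
proof -
  have "sseq c t (Suc (Suc i)) = (\<Sum>j<i. aseq c (Suc (Suc i) - j + 1) * t j) + int c * t i + t (Suc i)"
    by (simp add: sseq_def Suc_diff_le)
  also have "(\<Sum>j<i. aseq c (Suc (Suc i) - j + 1) * t j) =
      (\<Sum>j<i. int c * (aseq c (Suc i - j + 1) * t j) - aseq c (i - j + 1) * t j)"
  proof (rule sum.cong)
    fix j assume "j \<in> {..<i}"
    then have "Suc (Suc i) - j + 1 = Suc (Suc (Suc (i - j)))" "Suc i - j + 1 = Suc (Suc (i - j))"
      by auto
    then show "aseq c (Suc (Suc i) - j + 1) * t j =
        int c * (aseq c (Suc i - j + 1) * t j) - aseq c (i - j + 1) * t j"
      by (simp add: algebra_simps)
  qed simp
  also have "\<dots> = int c * (sseq c t (Suc i) - t i) - sseq c t i"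
    by (simp add: sseq_def sum_subtractf sum_distrib_left Suc_diff_le)
  finally show ?thesis
    by (simp add: algebra_simps)
qed

lemma slack_0 [simp]: "slack c t 0 = 0"
  by (simp add: slack_def sseq_def)

lemma slack_Suc_0 [simp]: "slack c t (Suc 0) = 1 - int c * t 0"
  by (simp add: slack_def sseq_def)

text \<open>This is the substitution acting on exponents: with p = -\<open>slack c t i\<close> and q
  = \<open>slack c t (Suc i)\<close>, picking x2^(c (q - t)) from (1 + x2^c)^q sends (p, q) to (-q,
  p + c (q - t)), where t is the entry at \<open>Suc i\<close>.\<close>

lemma slack_Suc_Suc:
  "slack c t (Suc (Suc i)) = int c * (slack c t (Suc i) - t (Suc i)) - slack c t i"
  by (simp add: slack_def sseq_Suc_Suc algebra_simps)

lemma slack_upd [simp]: "i \<le> j \<Longrightarrow> slack c (t(j := k)) i = slack c t i"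
  by (simp add: slack_def sseq_def)

definition bounded_tuples :: "nat \<Rightarrow> nat \<Rightarrow> (nat \<Rightarrow> int) set" where
  "bounded_tuples c m = {t \<in> {..<m} \<rightarrow>\<^sub>E UNIV. \<forall>i<m. 0 \<le> t i \<and> t i \<le> slack c t i}"

definition tuple_weight :: "nat \<Rightarrow> nat \<Rightarrow> (nat \<Rightarrow> int) \<Rightarrow> rat" where
  "tuple_weight c m t = (\<Prod>i<m. mod_binomial (slack c t i) (t i))"

lemma tuple_weight_upd:
  "tuple_weight c (Suc m) (t(m := k)) = tuple_weight c m t * mod_binomial (slack c t m) k"
  by (simp add: tuple_weight_def)

lemma bounded_tuples_upd_undefined:
  assumes "t \<in> bounded_tuples c m"
  shows "t(m := undefined) = t"
  using assms by (auto simp: bounded_tuples_def PiE_iff extensional_def)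

lemma upd_mem_bounded_tuples:
  assumes "t \<in> bounded_tuples c m" "0 \<le> k" "k \<le> slack c t m"
  shows "t(m := k) \<in> bounded_tuples c (Suc m)"
  using assms by (auto simp: bounded_tuples_def PiE_iff extensional_def less_Suc_eq)

lemma restrict_mem_bounded_tuples:
  assumes "t \<in> {..m} \<rightarrow>\<^sub>E UNIV" "\<forall>i<m. 0 \<le> t i \<and> t i \<le> slack c t i"
  shows "t(m := undefined) \<in> bounded_tuples c m"
  using assms by (auto simp: bounded_tuples_def PiE_iff extensional_def)

lemma bounded_tuples_0: "bounded_tuples c 0 = {\<lambda>_. undefined}"
  by (simp add: bounded_tuples_def)

text \<open>The bound on the new entry depends only on the earlier entries, so tuples can be
  extended one entry at a time.\<close>

lemma bounded_tuples_Suc: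
  "bij_betw (\<lambda>(t, k). t(m := k)) (SIGMA t:bounded_tuples c m. {0..slack c t m})
    (bounded_tuples c (Suc m))"
proof (rule bij_betw_byWitness[where f' = "\<lambda>t. (t(m := undefined), t m)"])
  show "(\<lambda>t. (t(m := undefined), t m)) ` bounded_tuples c (Suc m)
      \<subseteq> (SIGMA t:bounded_tuples c m. {0..slack c t m})"
  proof clarify
    fix t assume t: "t \<in> bounded_tuples c (Suc m)"
    then have "t(m := undefined) \<in> bounded_tuples c m"
      by (intro restrict_mem_bounded_tuples) (auto simp: bounded_tuples_def lessThan_Suc_atMost)
    then show "t(m := undefined) \<in> bounded_tuples c m \<and> t m \<in> {0..slack c (t(m := undefined)) m}"
      using t by (simp add: bounded_tuples_def)
  qed
qed (auto simp: bounded_tuples_upd_undefined upd_mem_bounded_tuples)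

lemma finite_bounded_tuples: "finite (bounded_tuples c m)"
proof (induction m)
  case (Suc m)
  then show ?case
    using bij_betw_finite[OF bounded_tuples_Suc, of c m] by simp
qed (simp add: bounded_tuples_0)

lemma sum_bounded_tuples_Suc:
  "(\<Sum>t\<in>bounded_tuples c (Suc m). f t) =
    (\<Sum>t\<in>bounded_tuples c m. \<Sum>k\<in>{0..slack c t m}. f (t(m := k)))"
  unfolding sum.reindex_bij_betw[OF bounded_tuples_Suc, symmetric]
  by (subst sum.Sigma) (simp_all add: finite_bounded_tuples case_prod_unfold)

text \<open>The denominators multiply to (A - B)!. The lower index is A - B rather than B, which is
  what the binomial series requires when A is negative.\<close>

lemma mod_binomial_eq_gbinomial:
  assumes "B \<le> A"
  shows "mod_binomial A B = (of_int A gchoose nat (A - B) :: 'a::field_char_0)"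
proof -
  have "mod_binomial A B = (\<Prod>i<nat (A - B). of_int (A - int i) / of_int (A - B - int i) :: 'a)"
    using assms by (simp add: mod_binomial_def)
  also have "\<dots> = (\<Prod>i<nat (A - B). of_int A - of_nat i) / (\<Prod>i<nat (A - B). of_nat (nat (A - B) - i))"
    unfolding prod_dividef[symmetric]
  proof (rule prod.cong)
    fix i assume "i \<in> {..<nat (A - B)}"
    then have "of_nat (nat (A - B) - i) = (of_int (A - B - int i) :: 'a)"
      using assms by (simp add: of_nat_diff)
    then show "of_int (A - int i) / of_int (A - B - int i) =
        (of_int A - of_nat i) / (of_nat (nat (A - B) - i) :: 'a)"
      by simp
  qed simp
  also have "(\<Prod>i<nat (A - B). of_nat (nat (A - B) - i)) = (fact (nat (A - B)) :: 'a)"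
    by (simp add: fact_prod_rev atLeast0LessThan)
  finally show ?thesis
    by (simp add: gbinomial_prod_rev atLeast0LessThan)
qed

text \<open>At most k = q - d / c contributes. Since q is nonnegative, the expansion is finite and
  the range of k covers all of it.\<close>

lemma sum_mod_binomial:
  assumes "c > 0" "q \<ge> 0"
  shows "(\<Sum>k\<in>{0..q}. if int c * (q - k) = d then mod_binomial q k else 0) = exchange_coeff c q d"
proof (cases "0 \<le> d \<and> int c dvd d \<and> d div int c \<le> q")
  case True
  then obtain e where e: "d = int c * e"
    by blast
  have "0 \<le> e" "e \<le> q"
    using True assms by (simp_all add: e zero_le_mult_iff)
  then have "(\<Sum>k\<in>{0..q}. if int c * (q - k) = d then mod_binomial q k else 0) =
      (\<Sum>k\<in>{0..q}. if k = q - e then mod_binomial q k else (0 :: rat))"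
    using assms by (intro sum.cong) (auto simp: e)
  also have "\<dots> = mod_binomial q (q - e)"
    using \<open>0 \<le> e\<close> \<open>e \<le> q\<close> by simp
  also have "\<dots> = exchange_coeff c q d"
    using \<open>0 \<le> e\<close> assms by (simp add: mod_binomial_eq_gbinomial exchange_coeff_def e)
  finally show ?thesis .
next
  case False
  have "int c * (q - k) \<noteq> d" if "k \<in> {0..q}" for k
    using False that assms by auto
  then have "(\<Sum>k\<in>{0..q}. if int c * (q - k) = d then mod_binomial q k else 0) = (0 :: rat)"
    by (intro sum.neutral) simp
  also have "\<dots> = exchange_coeff c q d"
  proof (cases "0 \<le> d \<and> int c dvd d")
    case True
    then have "(of_nat (nat q) gchoose nat (d div int c) :: rat) = 0"
      using False assms by (subst binomial_gbinomial[symmetric]) (simp add: binomial_eq_0)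
    then show ?thesis
      using assms by (simp add: exchange_coeff_def)
  qed (auto simp: exchange_coeff_def)
  finally show ?thesis .
qed

section \<open>The recursion restricted to bounded tuples\<close>

definition bounded_coeff :: "nat \<Rightarrow> nat \<Rightarrow> int \<Rightarrow> int \<Rightarrow> rat" where
  "bounded_coeff c m p q = (\<Sum>t\<in>bounded_tuples c (Suc m).
     if slack c t m = - p \<and> slack c t (Suc m) = q then tuple_weight c (Suc m) t else 0)"

text \<open>One more substitution is applied to the terms counted by \<open>bounded_coeff\<close>,
  this time with the full binomial series, so i may also be positive.\<close>

definition expanded_coeff :: "nat \<Rightarrow> nat \<Rightarrow> int \<Rightarrow> int \<Rightarrow> rat" where
  "expanded_coeff c m i j = (\<Sum>t\<in>bounded_tuples c (Suc m).
     if slack c t (Suc m) = - i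
     then tuple_weight c (Suc m) t * exchange_coeff c (- i) (j + slack c t m) else 0)"

lemma expanded_coeff_eq_sum:
  assumes "finite P" "\<And>t. t \<in> bounded_tuples c (Suc m) \<Longrightarrow> - slack c t m \<in> P"
  shows "expanded_coeff c m i j =
    (\<Sum>p\<in>P. bounded_coeff c m p (- i) * exchange_coeff c (- i) (j - p))"
proof -
  have "expanded_coeff c m i j = (\<Sum>t\<in>bounded_tuples c (Suc m). \<Sum>p\<in>P.
      (if slack c t m = - p \<and> slack c t (Suc m) = - i then tuple_weight c (Suc m) t else 0) *
      exchange_coeff c (- i) (j - p))"
    unfolding expanded_coeff_def
  proof (rule sum.cong)
    fix t assume t: "t \<in> bounded_tuples c (Suc m)"
    have "(\<Sum>p\<in>P. (if slack c t m = - p \<and> slack c t (Suc m) = - i then tuple_weight c (Suc m) t else 0) *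
        exchange_coeff c (- i) (j - p)) =
        (\<Sum>p\<in>P. if p = - slack c t m then (if slack c t (Suc m) = - i
          then tuple_weight c (Suc m) t * exchange_coeff c (- i) (j + slack c t m) else 0) else 0)"
      by (intro sum.cong) auto
    also have "\<dots> = (if slack c t (Suc m) = - i
        then tuple_weight c (Suc m) t * exchange_coeff c (- i) (j + slack c t m) else 0)"
      using assms t by simp
    finally show "(if slack c t (Suc m) = - i
        then tuple_weight c (Suc m) t * exchange_coeff c (- i) (j + slack c t m) else 0) =
        (\<Sum>p\<in>P. (if slack c t m = - p \<and> slack c t (Suc m) = - i then tuple_weight c (Suc m) t else 0) *
        exchange_coeff c (- i) (j - p))" ..
  qed simp
  then show ?thesis
    by (subst (asm) sum.swap) (simp add: bounded_coeff_def sum_distrib_right)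
qed

lemma laurent_var_Suc_eq_sum:
  assumes "c \<ge> 1" "finite P" "fst ` Poly_Mapping.keys (laurent_var c n) \<subseteq> P"
  shows "of_int (Poly_Mapping.lookup (laurent_var c (Suc n)) (i, j)) =
    (\<Sum>p\<in>P. of_int (Poly_Mapping.lookup (laurent_var c n) (p, - i)) * exchange_coeff c (- i) (j - p))"
proof -
  have P: "a \<in> P" if "Poly_Mapping.lookup (laurent_var c n) (a, b) \<noteq> 0" for a b
    using that assms(3) by (force simp: in_keys_iff)
  have "of_int (Poly_Mapping.lookup (laurent_var c (Suc n)) (i, j)) =
      (\<Sum>k\<in>P \<times> {- i}. of_int (Poly_Mapping.lookup (laurent_var c n) k) *
        exchange_coeff c (snd k) (j - fst k))"
    unfolding laurent_var_Suc[OF assms(1)] using assms(2)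
    by (intro sum.mono_neutral_cong) (auto simp: in_keys_iff dest: P)
  also have "\<dots> = (\<Sum>p\<in>P. of_int (Poly_Mapping.lookup (laurent_var c n) (p, - i)) *
      exchange_coeff c (- i) (j - p))"
    by (simp flip: sum.cartesian_product' add: sum.cartesian_product'[of _ _ "{- i}"])
  finally show ?thesis .
qed

lemma laurent_var_neg_of_pos:
  assumes "c \<ge> 2" "n \<ge> 2" "Poly_Mapping.lookup (laurent_var c n) (p, q) \<noteq> 0" "p > 0"
  shows "q < 0"
proof (cases "n = 2")
  case True
  then show ?thesis
    using assms by (simp add: laurent_var_def numeral_2_eq_2 lookup_single when_def split: if_splits)
next
  case False
  then have "aseq c (n - 1) * p + aseq c (n - 2) * q < 0"
    using assms by (intro laurent_var_support) simp_all
  moreover have "0 \<le> aseq c (n - 1) * p"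
    using assms by (simp add: aseq_nonneg)
  ultimately have "aseq c (n - 2) * q < 0"
    by linarith
  then show ?thesis
    using aseq_nonneg[OF assms(1), of "n - 2"] by (simp add: mult_less_0_iff)
qed

lemma expanded_coeff_eq_laurent_var:
  assumes "c \<ge> 2" "i \<le> 0 \<or> j \<le> 0"
    and IH: "\<And>p q. bounded_coeff c m p q =
      (if p \<le> 0 then of_int (Poly_Mapping.lookup (laurent_var c (Suc (Suc m))) (p, q)) else 0)"
  shows "expanded_coeff c m i j = of_int (Poly_Mapping.lookup (laurent_var c (Suc (Suc (Suc m)))) (i, j))"
proof -
  let ?f = "laurent_var c (Suc (Suc m))"
  \<comment> \<open>P collects the first exponents from both sides, so that the two sums share one
    index set.\<close>
  define P where "P = (\<lambda>t. - slack c t m) ` bounded_tuples c (Suc m) \<union> fst ` Poly_Mapping.keys ?f"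
  have P: "finite P"
    by (simp add: P_def finite_bounded_tuples)
  have "expanded_coeff c m i j = (\<Sum>p\<in>P. bounded_coeff c m p (- i) * exchange_coeff c (- i) (j - p))"
    by (intro expanded_coeff_eq_sum P) (simp add: P_def)
  also have "\<dots> = (\<Sum>p\<in>P. of_int (Poly_Mapping.lookup ?f (p, - i)) * exchange_coeff c (- i) (j - p))"
  proof (rule sum.cong)
    fix p
    \<comment> \<open>For p > 0 the support gives -i < 0, hence j <= 0 by assumption. Then j - p <
      0, and the power series has no such term.\<close>
    have "exchange_coeff c (- i) (j - p) = 0"
      if "p > 0" "Poly_Mapping.lookup ?f (p, - i) \<noteq> 0"
      using laurent_var_neg_of_pos[OF assms(1) _ that(2,1)] assms(2) that(1)
      by (simp add: exchange_coeff_def)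
    then show "bounded_coeff c m p (- i) * exchange_coeff c (- i) (j - p) =
        of_int (Poly_Mapping.lookup ?f (p, - i)) * exchange_coeff c (- i) (j - p)"
      by (auto simp: IH)
  qed simp
  also have "\<dots> = of_int (Poly_Mapping.lookup (laurent_var c (Suc (Suc (Suc m)))) (i, j))"
    using assms(1) by (intro laurent_var_Suc_eq_sum[symmetric] P) (simp_all add: P_def)
  finally show ?thesis .
qed

text \<open>For i <= 0 the sum over the last entry is a complete binomial expansion. For i > 0 that
  entry has an empty range.\<close>

lemma bounded_coeff_Suc:
  assumes "c > 0"
  shows "bounded_coeff c (Suc m) i j = (if i \<le> 0 then expanded_coeff c m i j else 0)"
proof -
  have "bounded_coeff c (Suc m) i j = (\<Sum>t\<in>bounded_tuples c (Suc m). \<Sum>k\<in>{0..slack c t (Suc m)}.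
      if slack c t (Suc m) = - i \<and> int c * (slack c t (Suc m) - k) - slack c t m = j
      then tuple_weight c (Suc m) t * mod_binomial (slack c t (Suc m)) k else 0)"
    unfolding bounded_coeff_def sum_bounded_tuples_Suc[where m = "Suc m"] tuple_weight_upd
    by (simp add: slack_Suc_Suc)
  also have "\<dots> = (\<Sum>t\<in>bounded_tuples c (Suc m). if i \<le> 0 \<and> slack c t (Suc m) = - i
     then tuple_weight c (Suc m) t * exchange_coeff c (- i) (j + slack c t m) else 0)"
  proof (rule sum.cong)
    fix t
    show "(\<Sum>k\<in>{0..slack c t (Suc m)}.
        if slack c t (Suc m) = - i \<and> int c * (slack c t (Suc m) - k) - slack c t m = j
        then tuple_weight c (Suc m) t * mod_binomial (slack c t (Suc m)) k else 0) =
        (if i \<le> 0 \<and> slack c t (Suc m) = - i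
         then tuple_weight c (Suc m) t * exchange_coeff c (- i) (j + slack c t m) else 0)"
    proof (cases "i \<le> 0 \<and> slack c t (Suc m) = - i")
      case True
      then have "(\<Sum>k\<in>{0..slack c t (Suc m)}.
          if slack c t (Suc m) = - i \<and> int c * (slack c t (Suc m) - k) - slack c t m = j
          then tuple_weight c (Suc m) t * mod_binomial (slack c t (Suc m)) k else 0) =
          (\<Sum>k\<in>{0..- i}. tuple_weight c (Suc m) t *
            (if int c * (- i - k) = j + slack c t m then mod_binomial (- i) k else 0))"
        by (intro sum.cong) auto
      also have "\<dots> = tuple_weight c (Suc m) t * exchange_coeff c (- i) (j + slack c t m)"
        using assms True by (subst sum_distrib_left[symmetric], subst sum_mod_binomial) simp_all
      finally show ?thesis
        using True by simp
    qed auto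
  qed simp
  finally show ?thesis
    by (simp add: expanded_coeff_def)
qed

text \<open>
  The recursion for \<open>bounded_coeff\<close> differs from the one in \<open>laurent_var_Suc\<close> only by omitting the
  terms with \<open>p > 0\<close>. As those have \<open>q < 0\<close>, they affect only exponents \<open>(i, j)\<close> with \<open>i, j > 0\<close>.
\<close>

lemma bounded_coeff_eq_laurent_var:
  assumes "c \<ge> 2"
  shows "bounded_coeff c m p q =
    (if p \<le> 0 then of_int (Poly_Mapping.lookup (laurent_var c (Suc (Suc m))) (p, q)) else 0)"
proof (induction m arbitrary: p q)
  case 0
  \<comment> \<open>As \<open>slack c t 0\<close> is 0, only t_0 = 0 is allowed. It yields the
    monomial x2.\<close>
  have "bounded_coeff c 0 p q = (if p = 0 \<and> q = 1 then 1 else 0)"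
    unfolding bounded_coeff_def sum_bounded_tuples_Suc[where m = 0] bounded_tuples_0
    by (auto simp: tuple_weight_def mod_binomial_def)
  then show ?case
    by (simp add: laurent_var_def lookup_single when_def)
next
  case (Suc m)
  then show ?case
    using assms by (simp add: bounded_coeff_Suc expanded_coeff_eq_laurent_var)
qed

section \<open>The last entry and the summation condition\<close>

lemma of_rat_mod_binomial: "of_rat (mod_binomial A B) = (mod_binomial A B :: 'a::field_char_0)"
  unfolding mod_binomial_def by (auto simp: of_rat_prod of_rat_divide of_rat_diff)

text \<open>The difference of the two products is invariant under the recurrence and starts at
  -1.\<close>

lemma aseq_cassini: "aseq c (Suc n) * aseq c (Suc (Suc (Suc n))) = aseq c (Suc (Suc n)) ^ 2 - 1"
proof (induction n)
  case (Suc n)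
  have "aseq c (Suc (Suc n)) * aseq c (Suc (Suc (Suc (Suc n)))) - aseq c (Suc (Suc (Suc n))) ^ 2 =
      aseq c (Suc n) * aseq c (Suc (Suc (Suc n))) - aseq c (Suc (Suc n)) ^ 2"
    by (simp add: power2_eq_square algebra_simps)
  then show ?case
    using Suc by simp
qed simp

text \<open>Leaving the last entry free below admits negative values of
  \<open>slack c t (Suc m)\<close>, so its terms make up the full binomial series.\<close>

lemma sum_unrestricted_last_entry:
  fixes c m :: nat and i j :: int
  assumes "c > 0"
  defines "T \<equiv> {t \<in> {..Suc m} \<rightarrow>\<^sub>E UNIV. (\<forall>l\<le>m. 0 \<le> t l \<and> t l \<le> slack c t l) \<and>
    t (Suc m) \<le> slack c t (Suc m) \<and> slack c t (Suc m) = - i \<and> slack c t (Suc (Suc m)) = j}"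
  shows "finite T" "(\<Sum>t\<in>T. tuple_weight c (Suc (Suc m)) t) = expanded_coeff c m i j"
proof -
  define T0 where "T0 = {t \<in> bounded_tuples c (Suc m). slack c t (Suc m) = - i \<and>
    0 \<le> j + slack c t m \<and> int c dvd j + slack c t m}"
  \<comment> \<open>The last entry is determined by j: solve \<open>slack_Suc_Suc\<close> for it.
    The conditions in \<open>T0\<close> make the solution integral and at most the slack.\<close>
  define h where "h = (\<lambda>t. t(Suc m := - i - (j + slack c t m) div int c))"
  have bij: "bij_betw h T0 T"
  proof (rule bij_betw_byWitness[where f' = "\<lambda>t. t(Suc m := undefined)"])
    show "\<forall>t\<in>T0. (h t)(Suc m := undefined) = t"
      by (auto simp: T0_def h_def bounded_tuples_upd_undefined)
    show "\<forall>t\<in>T. h (t(Suc m := undefined)) = t"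
      using assms by (auto simp: T_def h_def slack_Suc_Suc)
    show "h ` T0 \<subseteq> T"
      using assms
      by (auto simp: T_def T0_def h_def bounded_tuples_def PiE_iff extensional_def slack_Suc_Suc
          less_Suc_eq_le pos_imp_zdiv_nonneg_iff)
    show "(\<lambda>t. t(Suc m := undefined)) ` T \<subseteq> T0"
    proof clarify
      fix t assume t: "t \<in> T"
      then have "t(Suc m := undefined) \<in> bounded_tuples c (Suc m)"
        by (intro restrict_mem_bounded_tuples) (simp_all add: T_def less_Suc_eq_le)
      then show "t(Suc m := undefined) \<in> T0"
        using t by (auto simp: T_def T0_def slack_Suc_Suc)
    qed
  qed
  have "finite T0"
    by (simp add: T0_def finite_bounded_tuples)
  then show "finite T"
    using bij bij_betw_finite by blast
  have "(\<Sum>t\<in>T. tuple_weight c (Suc (Suc m)) t) = (\<Sum>t\<in>T0. tuple_weight c (Suc (Suc m)) (h t))"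
    by (rule sum.reindex_bij_betw[OF bij, symmetric])
  also have "\<dots> = (\<Sum>t\<in>T0. tuple_weight c (Suc m) t * exchange_coeff c (- i) (j + slack c t m))"
    using assms(1)
    by (intro sum.cong)
       (simp_all add: T0_def h_def tuple_weight_upd mod_binomial_eq_gbinomial exchange_coeff_def
         pos_imp_zdiv_nonneg_iff)
  also have "\<dots> = expanded_coeff c m i j"
    unfolding expanded_coeff_def
    by (intro sum.mono_neutral_cong_left) (auto simp: T0_def finite_bounded_tuples exchange_coeff_def)
  finally show "(\<Sum>t\<in>T. tuple_weight c (Suc (Suc m)) t) = expanded_coeff c m i j" .
qed

text \<open>By \<open>aseq_cassini\<close> the linear form equals c x - 1, where -x is the left side
  of the last summation condition. For integers, c x - 1 < 0 means x <= 0.\<close>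

lemma summation_tuples_iff:
  "t \<in> summation_tuples c (Suc (Suc (Suc m))) \<longleftrightarrow> t \<in> {..Suc m} \<rightarrow>\<^sub>E UNIV \<and>
    (\<forall>i\<le>m. 0 \<le> t i \<and> t i \<le> slack c t i) \<and>
    - aseq c (Suc (Suc m)) * slack c t (Suc m) + aseq c (Suc m) * slack c t (Suc (Suc m)) < 0"
  if "c > 0"
proof -
  let ?a = "aseq c" and ?s = "sseq c t"
  have "- ?a (Suc (Suc m)) * slack c t (Suc m) + ?a (Suc m) * slack c t (Suc (Suc m)) =
      int c * (?s (Suc m) * ?a (Suc (Suc m)) - ?s (Suc (Suc m)) * ?a (Suc m)) - 1"
    using aseq_cassini[of c m] by (simp add: slack_def algebra_simps power2_eq_square)
  moreover have "int c * x - 1 < 0 \<longleftrightarrow> - x \<ge> 0" for x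
    using that by (simp add: mult_le_0_iff flip: zle_diff1_eq)
  ultimately have "?s (Suc (Suc m)) * ?a (Suc m) - ?s (Suc m) * ?a (Suc (Suc m)) \<ge> 0 \<longleftrightarrow>
      - ?a (Suc (Suc m)) * slack c t (Suc m) + ?a (Suc m) * slack c t (Suc (Suc m)) < 0"
    by simp
  then show ?thesis
    by (auto simp: summation_tuples_def slack_def atMost_atLeast0)
qed

theorem theorem2p1:
  fixes b c n :: nat
  assumes "b = c" and "c \<ge> 2" and "n \<ge> 3"
  shows "cluster_var b c (int n) =
    X1 powi (- aseq c (n - 1)) * X2 powi (- aseq c (n - 2)) *
    sum' (\<lambda>t. (\<Prod>i=0..n-2. mod_binomial (aseq c (i + 1) - int c * sseq c t i) (t i)) *
            X1 powi (int c * sseq c t (n - 2)) *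
            X2 powi (int c * (aseq c (n - 1) - sseq c t (n - 1))))
         (summation_tuples c n)"
proof -
  obtain m where n: "n = Suc (Suc (Suc m))"
    using assms(3) by (intro that[of "n - 3"]) simp
  have nz: "X1 \<noteq> 0" "X2 \<noteq> 0"
    using X1_pos X2_pos by auto
  let ?w = "tuple_weight c (Suc (Suc m))"
  let ?f = "laurent_var c n"
  define mono where "mono = (\<lambda>(i, j). X1 powi i * X2 powi j)"
  define e where "e t = (- slack c t (Suc m), slack c t (Suc (Suc m)))" for t
  define S where "S = {t \<in> summation_tuples c n. ?w t \<noteq> 0}"
  define H where "H = {(i, j). aseq c (Suc (Suc m)) * i + aseq c (Suc m) * j < 0}"
  \<comment> \<open>Both families of exponents are joined so that they can be compared termwise. All
    of them lie in the half-plane \<open>H\<close>, where \<open>coeff\<close> applies.\<close>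
  define Y where "Y = e ` S \<union> Poly_Mapping.keys ?f"

  have prod: "(\<Prod>i=0..n-2. mod_binomial (aseq c (i + 1) - int c * sseq c t i) (t i)) =
      (of_rat (?w t) :: ratfun2)" for t
    unfolding tuple_weight_def of_rat_prod of_rat_mod_binomial
    by (intro prod.cong) (auto simp: n slack_def)
  have finS: "finite S"
    using finite_nonzero_terms[OF assms(2,3), where ?'a = ratfun2] unfolding prod S_def by simp
  have expo: "X1 powi (- aseq c (n - 1)) * X2 powi (- aseq c (n - 2)) *
      (X1 powi (int c * sseq c t (n - 2)) * X2 powi (int c * (aseq c (n - 1) - sseq c t (n - 1)))) =
      mono (e t)" for t
  proof -
    have "- aseq c (n - 1) + int c * sseq c t (n - 2) = - slack c t (Suc m)"
      "- aseq c (n - 2) + int c * (aseq c (n - 1) - sseq c t (n - 1)) = slack c t (Suc (Suc m))"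
      by (simp_all add: n slack_def algebra_simps)
    then show ?thesis
      unfolding mono_def e_def prod.case using nz
      by (simp add: mult_ac flip: power_int_add)
  qed
  have SH: "e ` S \<subseteq> H"
    using assms(2) by (auto simp: S_def H_def e_def n summation_tuples_iff)
  have KH: "Poly_Mapping.keys ?f \<subseteq> H"
    using laurent_var_support[OF assms(2,3)] by (auto simp: H_def in_keys_iff n)
  have YH: "Y \<subseteq> H"
    using SH KH by (simp add: Y_def)
  have last_le: "t (Suc m) \<le> slack c t (Suc m)" if "?w t \<noteq> 0" for t
  proof -
    have "mod_binomial (slack c t (Suc m)) (t (Suc m)) \<noteq> (0 :: rat)"
      using that by (simp add: tuple_weight_def)
    then show ?thesis
      by (simp add: mod_binomial_def split: if_splits)
  qed
  have coeff: "(\<Sum>t | t \<in> S \<and> e t = y. ?w t) = of_int (Poly_Mapping.lookup ?f y)" if "y \<in> H" for y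
  proof -
    obtain i j where y: "y = (i, j)"
      by fastforce
    have c: "c > 0"
      using assms(2) by simp
    have "i \<le> 0 \<or> j \<le> 0"
    proof (rule ccontr)
      assume "\<not> (i \<le> 0 \<or> j \<le> 0)"
      then have "0 \<le> aseq c (Suc (Suc m)) * i" "0 \<le> aseq c (Suc m) * j"
        using aseq_nonneg[OF assms(2)] by simp_all
      then show False
        using that by (simp add: y H_def)
    qed
    then have "of_int (Poly_Mapping.lookup ?f y) = expanded_coeff c m i j"
      unfolding y n
      by (intro expanded_coeff_eq_laurent_var[symmetric] bounded_coeff_eq_laurent_var assms(2))
    \<comment> \<open>A nonzero weight forces the upper bound on the last entry, and y in
      \<open>H\<close> supplies the last summation condition. The tuples outside \<open>S\<close>
      therefore have weight zero.\<close>
    also have "\<dots> = (\<Sum>t | t \<in> S \<and> e t = y. ?w t)"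
      unfolding sum_unrestricted_last_entry(2)[OF c, symmetric]
      using that c
      by (intro sum.mono_neutral_right sum_unrestricted_last_entry(1))
         (auto simp: S_def H_def e_def y n summation_tuples_iff last_le)
    finally show ?thesis ..
  qed

  have "X1 powi (- aseq c (n - 1)) * X2 powi (- aseq c (n - 2)) *
    sum' (\<lambda>t. (\<Prod>i=0..n-2. mod_binomial (aseq c (i + 1) - int c * sseq c t i) (t i)) *
            X1 powi (int c * sseq c t (n - 2)) *
            X2 powi (int c * (aseq c (n - 1) - sseq c t (n - 1))))
         (summation_tuples c n) =
    X1 powi (- aseq c (n - 1)) * X2 powi (- aseq c (n - 2)) *
    (\<Sum>t\<in>S. of_rat (?w t) * X1 powi (int c * sseq c t (n - 2)) *
            X2 powi (int c * (aseq c (n - 1) - sseq c t (n - 1))))"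
    unfolding prod using finS
    by (subst sum.mono_neutral_right'[of S]) (auto simp: S_def)
  also have "\<dots> = (\<Sum>t\<in>S. of_rat (?w t) * mono (e t))"
    unfolding sum_distrib_left by (intro sum.cong) (simp_all add: mult_ac flip: expo)
  also have "\<dots> = (\<Sum>y\<in>Y. \<Sum>t | t \<in> S \<and> e t = y. of_rat (?w t) * mono (e t))"
    using finS by (intro sum.group[symmetric]) (auto simp: Y_def)
  also have "\<dots> = (\<Sum>y\<in>Y. of_rat (\<Sum>t | t \<in> S \<and> e t = y. ?w t) * mono y)"
    by (simp add: of_rat_sum sum_distrib_right)
  also have "\<dots> = (\<Sum>y\<in>Y. of_int (Poly_Mapping.lookup ?f y) * mono y)"
    by (intro sum.cong) (simp_all add: coeff subsetD[OF YH])
  also have "\<dots> = (\<Sum>y\<in>Poly_Mapping.keys ?f. of_int (Poly_Mapping.lookup ?f y) * mono y)"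
    using finS by (intro sum.mono_neutral_right) (auto simp: Y_def in_keys_iff)
  also have "\<dots> = laurent_eval X1 X2 ?f"
    by (simp add: laurent_eval_def mono_def case_prod_unfold)
  also have "\<dots> = cluster_var b c (int n)"
    using assms nz by (simp add: laurent_eval_laurent_var cluster_var_eq_cluster_seq)
  finally show ?thesis ..
qed

end
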